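(* Let $X$ be a finite nonempty set and let $r$ be a Zadeh's fuzzy order on $X$. Let $\mathcal{A}$ be the set of all linear Zadeh's fuzzy orders $s$ on $X$ that extend $r$ (i.e. $r(x,y)\le s(x,y)$ for all $(x,y)\in X^2$). Then $r$ is the fuzzy intersection of the elements of $\mathcal{A}$, that is, $r(x,y)=\inf_{s\in\mathcal{A}} s(x,y)$ for every $(x,y)\in X^2$.
   Context: A fuzzy relation on a nonempty set $X$ is a function $r: X\times X\to[0,1]$. A Zadeh's fuzzy order on $X$ is a fuzzy relation $r$ satisfying: (i) $r(x,x)=1$ for all $x\in X$; (ii) for all $x,y\in X$, if $x\neq y$ and $r(x,y)>0$ then $r(y,x)=0$; (iii) for all $x,z\in X$, $r(x,z)\ge \sup_{y\in X}\min\{r(x,y),r(y,z)\}$. A Zadeh's fuzzy order $r$ is linear if for all $x,y\in X$, $r(x,y)>0$ or $r(y,x)>0$. The fuzzy intersection of a family of fuzzy relations is their pointwise infimum. *)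

theory Defs
  imports Complex_Main
begin

text \<open>
  Fuzzy relations on a set \<open>X\<close> are total functions on the ambient type; their values outside
  \<open>X \<times> X\<close> are unconstrained and are never inspected.
\<close>

definition fuzzy_relation_on :: "'a set \<Rightarrow> ('a \<Rightarrow> 'a \<Rightarrow> real) \<Rightarrow> bool" where
  "fuzzy_relation_on X r \<longleftrightarrow> (\<forall>x\<in>X. \<forall>y\<in>X. r x y \<in> {0..1})"

text \<open>
  On a nonempty \<open>X\<close> the real supremum below is a genuine one, and it agrees with the supremum
  in \<open>[0,1]\<close>, because all values lie in that interval.
\<close>

definition zadeh_fuzzy_order_on :: "'a set \<Rightarrow> ('a \<Rightarrow> 'a \<Rightarrow> real) \<Rightarrow> bool" where
  "zadeh_fuzzy_order_on X r \<longleftrightarrow>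
     fuzzy_relation_on X r \<and>
     (\<forall>x\<in>X. r x x = 1) \<and>
     (\<forall>x\<in>X. \<forall>y\<in>X. x \<noteq> y \<and> r x y > 0 \<longrightarrow> r y x = 0) \<and>
     (\<forall>x\<in>X. \<forall>z\<in>X. r x z \<ge> (SUP y\<in>X. min (r x y) (r y z)))"

definition linear_zadeh_fuzzy_order_on :: "'a set \<Rightarrow> ('a \<Rightarrow> 'a \<Rightarrow> real) \<Rightarrow> bool" where
  "linear_zadeh_fuzzy_order_on X r \<longleftrightarrow>
     zadeh_fuzzy_order_on X r \<and> (\<forall>x\<in>X. \<forall>y\<in>X. r x y > 0 \<or> r y x > 0)"

definition fuzzy_extends_on :: "'a set \<Rightarrow> ('a \<Rightarrow> 'a \<Rightarrow> real) \<Rightarrow> ('a \<Rightarrow> 'a \<Rightarrow> real) \<Rightarrow> bool" where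
  "fuzzy_extends_on X r s \<longleftrightarrow> (\<forall>x\<in>X. \<forall>y\<in>X. r x y \<le> s x y)"

definition linear_extensions_on ::
    "'a set \<Rightarrow> ('a \<Rightarrow> 'a \<Rightarrow> real) \<Rightarrow> ('a \<Rightarrow> 'a \<Rightarrow> real) set" where
  "linear_extensions_on X r = {s. linear_zadeh_fuzzy_order_on X s \<and> fuzzy_extends_on X r s}"

text \<open>
  The infimum is taken in the reals: on \<open>X \<times> X\<close> it is the infimum in \<open>[0,1]\<close> for a nonempty
  family of fuzzy relations on \<open>X\<close>, and unspecified (not \<open>1\<close>) for the empty family.
\<close>

definition fuzzy_Inter :: "('a \<Rightarrow> 'a \<Rightarrow> real) set \<Rightarrow> 'a \<Rightarrow> 'a \<Rightarrow> real" where
  "fuzzy_Inter A x y = (INF s\<in>A. s x y)"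

end

(*
  For a linear order L extending the support {r > 0} and any 0 < d <= 1, the relation equal to
  max r d on L and to 0 off L is a linear Zadeh's fuzzy order extending r; it is transitive because
  min (max u d) (max v d) = max (min u v) d. The infimum at (a, b) is therefore attained: if
  r a b > 0, take d = r a b; if r a b = 0, choose L with b strictly below a, which is possible
  because adding the pair (b, a) to the support creates no cycle.
*)
theory Submission
  imports Defs
begin

text \<open>Topological sorting by induction on \<open>X\<close>: a finite acyclic relation has a
  minimal element, which is ranked below everything else. Injectivity turns the ranking into a
  linear order on \<open>X\<close>.\<close>

lemma acyclic_finite_ranking:
  fixes X :: "'a set"
  assumes "finite X" and "acyclic R"
  shows "\<exists>f :: 'a \<Rightarrow> nat. inj_on f X \<and> (\<forall>x\<in>X. \<forall>y\<in>X. (x, y) \<in> R \<longrightarrow> f x < f y)"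
  using assms(1)
proof (induction X rule: finite_psubset_induct)
  case (psubset X)
  show ?case
  proof (cases "X = {}")
    case False
    have "wf (R \<inter> X \<times> X)"
      using psubset.hyps assms(2) by (meson Int_lower1 Int_lower2 acyclic_subset finite_SigmaI
          finite_acyclic_wf finite_subset)
    then obtain m where m: "m \<in> X" and min: "\<And>y. (y, m) \<in> R \<inter> X \<times> X \<Longrightarrow> y \<notin> X"
      using False by (metis ex_in_conv wfE_min)
    obtain f :: "'a \<Rightarrow> nat" where inj: "inj_on f (X - {m})"
      and mono: "\<forall>x\<in>X - {m}. \<forall>y\<in>X - {m}. (x, y) \<in> R \<longrightarrow> f x < f y"
      using psubset.IH[of "X - {m}"] m by blast
    \<comment> \<open>Rank 0 is safe for \<open>m\<close> because \<open>min\<close> leaves it no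
      predecessor in \<open>X\<close>, itself included.\<close>
    let ?g = "\<lambda>x. if x = m then 0 else Suc (f x)"
    have "inj_on ?g X"
      using inj by (auto simp: inj_on_def)
    moreover have "\<forall>x\<in>X. \<forall>y\<in>X. (x, y) \<in> R \<longrightarrow> ?g x < ?g y"
      using min m mono by auto
    ultimately show ?thesis by blast
  qed simp
qed

text \<open>Values in the unit interval bound the supremum's family, and \<open>X\<close> is
  nonempty, so the real supremum unfolds to a pointwise bound. Outside that range both sides are
  false.\<close>

lemma zadeh_fuzzy_order_on_iff:
  assumes "X \<noteq> {}"
  shows "zadeh_fuzzy_order_on X r \<longleftrightarrow>
    (\<forall>x\<in>X. \<forall>y\<in>X. 0 \<le> r x y \<and> r x y \<le> 1) \<and>
    (\<forall>x\<in>X. r x x = 1) \<and>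
    (\<forall>x\<in>X. \<forall>y\<in>X. x \<noteq> y \<and> r x y > 0 \<longrightarrow> r y x = 0) \<and>
    (\<forall>x\<in>X. \<forall>y\<in>X. \<forall>z\<in>X. min (r x y) (r y z) \<le> r x z)"
proof (cases "\<forall>x\<in>X. \<forall>y\<in>X. 0 \<le> r x y \<and> r x y \<le> 1")
  case True
  have "(SUP y\<in>X. min (r x y) (r y z)) \<le> r x z \<longleftrightarrow> (\<forall>y\<in>X. min (r x y) (r y z) \<le> r x z)"
    if "x \<in> X" for x z
  proof -
    have "bdd_above ((\<lambda>y. min (r x y) (r y z)) ` X)"
      using True that by (intro bdd_aboveI2[where M = 1]) (auto intro: min.coboundedI1)
    with assms show ?thesis by (simp add: cSUP_le_iff)
  qed
  then have "(\<forall>x\<in>X. \<forall>z\<in>X. (SUP y\<in>X. min (r x y) (r y z)) \<le> r x z) \<longleftrightarrow>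
      (\<forall>x\<in>X. \<forall>y\<in>X. \<forall>z\<in>X. min (r x y) (r y z) \<le> r x z)"
    by blast
  with True show ?thesis
    by (simp add: zadeh_fuzzy_order_on_def fuzzy_relation_on_def)
qed (auto simp: zadeh_fuzzy_order_on_def fuzzy_relation_on_def)

text \<open>The linear order L is encoded as \<open>f x \<le> f y\<close>, antisymmetric on
  \<open>X\<close> since \<open>f\<close> is injective. The bound in \<open>mono\<close> is weak so
  that it covers the diagonal.\<close>

lemma max_on_ranking_in_linear_extensions_on:
  fixes f :: "'a \<Rightarrow> nat" and d :: real
  assumes "X \<noteq> {}" and r: "zadeh_fuzzy_order_on X r"
    and inj: "inj_on f X"
    and mono: "\<And>x y. x \<in> X \<Longrightarrow> y \<in> X \<Longrightarrow> r x y > 0 \<Longrightarrow> f x \<le> f y"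
    and d: "0 < d" "d \<le> 1"
  shows "(\<lambda>x y. if f x \<le> f y then max (r x y) d else 0) \<in> linear_extensions_on X r"
    (is "?s \<in> _")
proof -
  note r' = r[unfolded zadeh_fuzzy_order_on_iff[OF assms(1)]]
  have "min (?s x y) (?s y z) \<le> ?s x z" if "x \<in> X" "y \<in> X" "z \<in> X" for x y z
  proof -
    have "min (r x y) (r y z) \<le> r x z" using r' that by blast
    then have "min (max (r x y) d) (max (r y z) d) \<le> max (r x z) d"
      by linarith
    \<comment> \<open>If either pair on the left is off L, the left side is 0; otherwise L is
      transitive and the \<open>max\<close> inequality applies.\<close>
    then show ?thesis using d by auto
  qed
  moreover have "0 \<le> ?s x y \<and> ?s x y \<le> 1" if "x \<in> X" "y \<in> X" for x y
    using r' d that by auto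
  moreover have "?s x x = 1" if "x \<in> X" for x
    using r' d that by auto
  moreover have "?s y x = 0" if "x \<in> X" "y \<in> X" "x \<noteq> y" "?s x y > 0" for x y
    using that inj by (auto dest: inj_onD split: if_splits)
  ultimately have "zadeh_fuzzy_order_on X ?s"
    unfolding zadeh_fuzzy_order_on_iff[OF assms(1)] by blast
  moreover have "?s x y > 0 \<or> ?s y x > 0" for x y
    using d by auto
  moreover have "r x y \<le> ?s x y" if "x \<in> X" "y \<in> X" for x y
    using mono[OF that] by fastforce
  ultimately show ?thesis
    by (auto simp: linear_extensions_on_def linear_zadeh_fuzzy_order_on_def fuzzy_extends_on_def)
qed

lemma linear_extension_attaining:
  assumes "finite X" and r: "zadeh_fuzzy_order_on X r" and ab: "a \<in> X" "b \<in> X"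
  obtains s where "s \<in> linear_extensions_on X r" and "s a b = r a b"
proof -
  have ne: "X \<noteq> {}" using ab by blast
  note r' = r[unfolded zadeh_fuzzy_order_on_iff[OF ne]]
  define R where "R = {(x, y). x \<in> X \<and> y \<in> X \<and> x \<noteq> y \<and> r x y > 0}"
  have "trans R"
  proof (rule transI)
    fix x y z assume "(x, y) \<in> R" "(y, z) \<in> R"
    then have xyz: "x \<in> X" "y \<in> X" "z \<in> X" "x \<noteq> y" "r x y > 0" "r y z > 0"
      by (auto simp: R_def)
    \<comment> \<open>The second fact excludes \<open>z = x\<close>, as \<open>r y z\<close> is
      positive.\<close>
    then have "min (r x y) (r y z) \<le> r x z" and "r y x = 0" using r' by blast+
    with xyz show "(x, z) \<in> R" by (auto simp: R_def)
  qed
  then have R_tc: "R\<^sup>+ = R" by (rule trancl_id)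
  have acyc: "acyclic R"
    unfolding acyclic_def R_tc by (simp add: R_def)
  show thesis
  proof (cases "r a b > 0")
    case True
    obtain f :: "'a \<Rightarrow> nat" where f: "inj_on f X"
      "\<forall>x\<in>X. \<forall>y\<in>X. (x, y) \<in> R \<longrightarrow> f x < f y"
      using acyclic_finite_ranking[OF assms(1) acyc] by blast
    have mono: "f x \<le> f y" if "x \<in> X" "y \<in> X" "r x y > 0" for x y
      using f(2) that by (cases "x = y") (auto simp: R_def less_imp_le)
    have "r a b \<le> 1" using r' ab by blast
    \<comment> \<open>Here \<open>d\<close> is \<open>r a b\<close> itself, so the
      \<open>max\<close> at \<open>(a, b)\<close> collapses to \<open>r a b\<close>.\<close>
    from max_on_ranking_in_linear_extensions_on[OF ne r f(1) mono True this] that mono[OF ab True]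
    show thesis by simp
  next
    case False
    have "0 \<le> r a b" and "r a a = 1" using r' ab by blast+
    with False have 0: "r a b = 0" and "a \<noteq> b" by auto
    \<comment> \<open>Adding \<open>(b, a)\<close> closes a cycle only if \<open>R\<close> leads
      from \<open>a\<close> to \<open>b\<close>; by transitivity that would take a single step or
      \<open>a = b\<close>.\<close>
    then have "(a, b) \<notin> R\<^sup>*"
      unfolding rtrancl_eq_or_trancl R_tc by (simp add: R_def)
    with acyc have "acyclic (insert (b, a) R)" by simp
    then obtain f :: "'a \<Rightarrow> nat" where f: "inj_on f X"
      "\<forall>x\<in>X. \<forall>y\<in>X. (x, y) \<in> insert (b, a) R \<longrightarrow> f x < f y"
      using acyclic_finite_ranking[OF assms(1)] by blast
    have mono: "f x \<le> f y" if "x \<in> X" "y \<in> X" "r x y > 0" for x y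
      using f(2) that by (cases "x = y") (auto simp: R_def less_imp_le)
    \<comment> \<open>This puts \<open>(a, b)\<close> off L, where the extension is 0 whatever
      \<open>d\<close> is.\<close>
    have "f b < f a" using f(2) ab by blast
    with max_on_ranking_in_linear_extensions_on[OF ne r f(1) mono, of 1] that 0
    show thesis by simp
  qed
qed

theorem theorem3p1:
  fixes X :: "'a set" and r :: "'a \<Rightarrow> 'a \<Rightarrow> real"
  assumes "finite X" and "X \<noteq> {}"
    and "zadeh_fuzzy_order_on X r"
  shows "\<forall>x\<in>X. \<forall>y\<in>X. r x y = fuzzy_Inter (linear_extensions_on X r) x y"
proof (intro ballI)
  fix x y assume xy: "x \<in> X" "y \<in> X"
  obtain t where t: "t \<in> linear_extensions_on X r" "t x y = r x y"
    using linear_extension_attaining[OF assms(1,3) xy] by blast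
  show "r x y = fuzzy_Inter (linear_extensions_on X r) x y"
    unfolding fuzzy_Inter_def
  \<comment> \<open>The witness \<open>t\<close> makes the infimum a minimum and also shows that the
    family is nonempty.\<close>
  proof (rule cInf_eq_minimum[symmetric])
    show "r x y \<in> (\<lambda>s. s x y) ` linear_extensions_on X r"
      using t by (metis image_eqI)
    show "r x y \<le> v" if "v \<in> (\<lambda>s. s x y) ` linear_extensions_on X r" for v
      using that xy by (auto simp: linear_extensions_on_def fuzzy_extends_on_def)
  qed
qed

end
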